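(* Let $\mathcal{M}=(\mathcal{T},\mathcal{V},\mu)$ be an incremental model. Then for every non-deterministic functional network $\{(S_j,P_j)\}_{j\in J}$ in $\mathcal{M}$, where $(S_j,P_j)$ computes $F_j$ and $(S,P)$ is the network composition, \[ \mu_S(P)\subseteq\{\mathrm{lfp}(G_f)\mid f\in\textstyle\prod_{j\in J}F_j\}. \]
   Context: A cpo is a directed-complete poset with least element $\bot$; $\mathbf{Cpo}^s$ is the category of cpos and strict (bottom-preserving) Scott-continuous maps. $K(D)$ denotes the compact elements of $D$, $K(d)=\{b\in K(D)\mid b\sqsubseteq d\}$; $[D\to E]$ denotes continuous maps. Covering: $x\prec y$ iff $x\sqsubseteq y$, $x\ne y$ and no $z$ lies strictly between. Relative cover: $b\prec c$ relative to $d$ means $b,c\in K(d)$ and $b\prec c$. Fix a class of channel names; a sort is a set of channels; sorts form a poset under inclusion. A model $\mathcal{M}=(\mathcal{T},\mathcal{V},\mu)$ consists of functors $\mathcal{T},\mathcal{V}$ from (sorts ordered by inclusion)$^{\rm op}$ to $\mathbf{Cpo}^s$ and a natural transformation $\mu:\mathcal{T}\to\mathcal{V}$, with $\mathcal{V}$ preserving limits. Concretely: a cpo $\mathcal{T}_S$ for each sort $S$ and strict continuous restriction maps $\rho^S_T:\mathcal{T}_S\to\mathcal{T}_T$ for $S\supseteq T$ with $\rho^T_U\circ\rho^S_T=\rho^S_U$, $\rho^S_S=\mathrm{id}$; $\mathcal{V}_S=\prod_{\alpha\in S}\mathcal{V}_{\{\alpha\}}$ with restriction maps the projections $\pi^S_T$;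 strict continuous $\mu_S:\mathcal{T}_S\to\mathcal{V}_S$ with $\mu_T\circ\rho^S_T=\pi^S_T\circ\mu_S$. Write $\hat\rho^S_T=\mu_T\circ\rho^S_T$. An $\omega$-algebraic cpo $D$ is incremental if whenever $b\sqsubseteq c$ in $K(D)$ there is a finite chain $b=b_0\prec b_1\prec\cdots\prec b_n=c$. A strict continuous $f:D\to E$ between incremental domains is an incremental morphism if (i) whenever $b\prec c$ relative to $d$, either $f(b)\prec f(c)$ relative to $f(d)$, or $f(b)=f(c)\in K(f(d))$; and (ii) whenever $b'\prec c'$ relative to $d'$ and $d'=f(d)$, there exist $b,c$ with $b\prec c$ relative to $d$, $f(b)=b'$, $f(c)=c'$. The model is incremental if every $\mathcal{T}_S$ is an incremental domain and every $\rho^S_T$ is an incremental morphism. A process is $(S,P)$ with $P\subseteq\mathcal{T}_S$. The network composition of $\{(S_j,P_j)\}_{j\in J}$ is $(S,P)$ with $S=\bigcup_jS_j$, $P=\{t\in\mathcal{T}_S\mid\forall j.\ \rho^S_{S_j}(t)\in P_j\}$. A process $(S,P)$ with $S=I\cup O$ computes $F\subseteq[\mathcal{V}_I\to\mathcal{V}_O]$ if for all $t\in\mathcal{T}_S$: $t\in P$ iff there is $f\in F$ with (1) $\hat\rho^S_O(t)=f(\hat\rho^S_I(t))$ and (2) for all $u\prec v$ relative to $t$, $\hat\rho^S_O(v)\sqsubseteq f(\hat\rho^S_I(u))$. A non-deterministic functional network is a family $\{(S_j,P_j)\}_{j\in J}$ with each $S_j=I_j\cup O_j$ and $(S_j,P_j)$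 computing some $F_j\subseteq[\mathcal{V}_{I_j}\to\mathcal{V}_{O_j}]$, such that each $\alpha\in\bigcup_jS_j$ belongs to $O_j$ for exactly one $j$. For $f=(f_j)\in\prod_jF_j$, $G_f:\mathcal{V}_S\to\mathcal{V}_S$ has $\alpha$-component $\pi^{O_j}_{\{\alpha\}}\circ f_j\circ\pi^S_{I_j}$ for the unique $j$ with $\alpha\in O_j$; $\mathrm{lfp}(G_f)=\bigsqcup_kG_f^k(\bot)$. *)

theory Defs
  imports "HOL-Algebra.Complete_Lattice" "HOL-Library.Countable_Set"
begin

section \<open>Complete partial orders\<close>

definition directed :: "('a, 'm) gorder_scheme \<Rightarrow> 'a set \<Rightarrow> bool" where
  "directed L A \<longleftrightarrow>
     A \<subseteq> carrier L \<and> A \<noteq> {} \<and> (\<forall>x\<in>A. \<forall>y\<in>A. \<exists>z\<in>A. x \<sqsubseteq>\<^bsub>L\<^esub> z \<and> y \<sqsubseteq>\<^bsub>L\<^esub> z)"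

abbreviation is_lub :: "('a, 'm) gorder_scheme \<Rightarrow> 'a \<Rightarrow> 'a set \<Rightarrow> bool" where
  "is_lub L x A \<equiv> least L x (Upper L A)"

locale cpo = partial_order L + weak_partial_order_bottom L for L (structure) +
  assumes directed_complete: "directed L A \<Longrightarrow> \<exists>x. is_lub L x A"

definition scott_continuous ::
    "('a, 'm) gorder_scheme \<Rightarrow> ('b, 'n) gorder_scheme \<Rightarrow> ('a \<Rightarrow> 'b) \<Rightarrow> bool" where
  "scott_continuous D E f \<longleftrightarrow>
     f \<in> carrier D \<rightarrow> carrier E \<and>
     (\<forall>A x. directed D A \<longrightarrow> is_lub D x A \<longrightarrow> is_lub E (f x) (f ` A))"

definition strict_continuous ::
    "('a, 'm) gorder_scheme \<Rightarrow> ('b, 'n) gorder_scheme \<Rightarrow> ('a \<Rightarrow> 'b) \<Rightarrow> bool" where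
  "strict_continuous D E f \<longleftrightarrow> scott_continuous D E f \<and> f \<bottom>\<^bsub>D\<^esub> = \<bottom>\<^bsub>E\<^esub>"

text \<open>
  The set \<open>[D \<rightarrow> E]\<close>. Its elements are extensional, so that each map between the carriers is
  represented by exactly one HOL function.
\<close>

definition continuous_maps ::
    "('a, 'm) gorder_scheme \<Rightarrow> ('b, 'n) gorder_scheme \<Rightarrow> ('a \<Rightarrow> 'b) set" where
  "continuous_maps D E = {f \<in> carrier D \<rightarrow>\<^sub>E carrier E. scott_continuous D E f}"

definition kleene_lfp :: "('a, 'm) gorder_scheme \<Rightarrow> ('a \<Rightarrow> 'a) \<Rightarrow> 'a" where
  "kleene_lfp L g = \<Squnion>\<^bsub>L\<^esub> (range (\<lambda>k. (g ^^ k) \<bottom>\<^bsub>L\<^esub>))"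


section \<open>Incremental domains and morphisms\<close>

definition compacts :: "('a, 'm) gorder_scheme \<Rightarrow> 'a set" where
  "compacts D =
     {b \<in> carrier D. \<forall>A x. directed D A \<longrightarrow> is_lub D x A \<longrightarrow> b \<sqsubseteq>\<^bsub>D\<^esub> x \<longrightarrow> (\<exists>a\<in>A. b \<sqsubseteq>\<^bsub>D\<^esub> a)}"

definition compacts_below :: "('a, 'm) gorder_scheme \<Rightarrow> 'a \<Rightarrow> 'a set" where
  "compacts_below D d = {b \<in> compacts D. b \<sqsubseteq>\<^bsub>D\<^esub> d}"

definition covers :: "('a, 'm) gorder_scheme \<Rightarrow> 'a \<Rightarrow> 'a \<Rightarrow> bool" where
  "covers D x y \<longleftrightarrow>
     x \<in> carrier D \<and> y \<in> carrier D \<and> x \<sqsubset>\<^bsub>D\<^esub> y \<and>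
     \<not> (\<exists>z\<in>carrier D. x \<sqsubset>\<^bsub>D\<^esub> z \<and> z \<sqsubset>\<^bsub>D\<^esub> y)"

definition covers_rel :: "('a, 'm) gorder_scheme \<Rightarrow> 'a \<Rightarrow> 'a \<Rightarrow> 'a \<Rightarrow> bool" where
  "covers_rel D d b c \<longleftrightarrow>
     b \<in> compacts_below D d \<and> c \<in> compacts_below D d \<and> covers D b c"

locale omega_algebraic_cpo = cpo D for D (structure) +
  assumes countable_compacts: "countable (compacts D)"
    and directed_compacts_below: "d \<in> carrier D \<Longrightarrow> directed D (compacts_below D d)"
    and lub_compacts_below: "d \<in> carrier D \<Longrightarrow> is_lub D d (compacts_below D d)"

text \<open>
  In an algebraic cpo every element covering a compact element is compact, so the elements of
  a covering chain that starts at a compact element need not be required to be compact.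
\<close>

locale incremental_domain = omega_algebraic_cpo D for D (structure) +
  assumes covering_chain:
    "\<lbrakk>b \<in> compacts D; c \<in> compacts D; b \<sqsubseteq> c\<rbrakk> \<Longrightarrow> (covers D)\<^sup>*\<^sup>* b c"

locale incremental_morphism =
  dom: incremental_domain D + cod: incremental_domain E
  for D :: "('a, 'm) gorder_scheme" and E :: "('b, 'n) gorder_scheme" and f :: "'a \<Rightarrow> 'b" +
  assumes strict_continuous: "strict_continuous D E f"
    and preserves_covers:
      "\<lbrakk>d \<in> carrier D; covers_rel D d b c\<rbrakk> \<Longrightarrow>
         covers_rel E (f d) (f b) (f c) \<or> (f b = f c \<and> f b \<in> compacts_below E (f d))"
    and lifts_covers:
      "\<lbrakk>d \<in> carrier D; covers_rel E (f d) b' c'\<rbrakk> \<Longrightarrow>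
         \<exists>b c. covers_rel D d b c \<and> f b = b' \<and> f c = c'"


section \<open>Models\<close>

text \<open>
  A sort is a set over the type \<open>'c\<close> of channel names. The posets of traces of the various sorts
  are carriers inside one type \<open>'t\<close>. The functor of values is given by one poset of values for each
  channel. For a sort \<open>S\<close> it yields the product over \<open>S\<close>, and its restriction maps are the
  projections.
\<close>

record ('c, 't, 'v) trace_model =
  traces :: "'c set \<Rightarrow> 't gorder"
  trace_restr :: "'c set \<Rightarrow> 'c set \<Rightarrow> 't \<Rightarrow> 't"
  channel_vals :: "'c \<Rightarrow> 'v gorder"
  obs :: "'c set \<Rightarrow> 't \<Rightarrow> 'c \<Rightarrow> 'v"

definition product_order :: "'c set \<Rightarrow> ('c \<Rightarrow> 'v gorder) \<Rightarrow> ('c \<Rightarrow> 'v) gorder" where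
  "product_order S V =
     \<lparr>carrier = (\<Pi>\<^sub>E \<alpha>\<in>S. carrier (V \<alpha>)), eq = (=), le = (\<lambda>x y. \<forall>\<alpha>\<in>S. x \<alpha> \<sqsubseteq>\<^bsub>V \<alpha>\<^esub> y \<alpha>)\<rparr>"

definition vals :: "('c, 't, 'v) trace_model \<Rightarrow> 'c set \<Rightarrow> ('c \<Rightarrow> 'v) gorder" where
  "vals M S = product_order S (channel_vals M)"

locale model =
  fixes M :: "('c, 't, 'v) trace_model"
  assumes traces_cpo: "cpo (traces M S)"
    and trace_restr_strict_continuous:
      "T \<subseteq> S \<Longrightarrow> strict_continuous (traces M S) (traces M T) (trace_restr M S T)"
    and trace_restr_id: "t \<in> carrier (traces M S) \<Longrightarrow> trace_restr M S S t = t"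
    and trace_restr_trans:
      "\<lbrakk>U \<subseteq> T; T \<subseteq> S; t \<in> carrier (traces M S)\<rbrakk> \<Longrightarrow>
         trace_restr M T U (trace_restr M S T t) = trace_restr M S U t"
    and channel_vals_cpo: "cpo (channel_vals M \<alpha>)"
    and obs_strict_continuous: "strict_continuous (traces M S) (vals M S) (obs M S)"
    and obs_natural:
      "\<lbrakk>T \<subseteq> S; t \<in> carrier (traces M S)\<rbrakk> \<Longrightarrow>
         obs M T (trace_restr M S T t) = restrict (obs M S t) T"

locale incremental_model = model M for M :: "('c, 't, 'v) trace_model" +
  assumes traces_incremental: "incremental_domain (traces M S)"
    and trace_restr_incremental:
      "T \<subseteq> S \<Longrightarrow> incremental_morphism (traces M S) (traces M T) (trace_restr M S T)"

definition obs_restr ::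
    "('c, 't, 'v) trace_model \<Rightarrow> 'c set \<Rightarrow> 'c set \<Rightarrow> 't \<Rightarrow> 'c \<Rightarrow> 'v" where
  "obs_restr M S T t = obs M T (trace_restr M S T t)"


section \<open>Processes and networks\<close>

type_synonym ('c, 't) process = "'c set \<times> 't set"

definition is_process :: "('c, 't, 'v) trace_model \<Rightarrow> ('c, 't) process \<Rightarrow> bool" where
  "is_process M = (\<lambda>(S, P). P \<subseteq> carrier (traces M S))"

definition network_composition ::
    "('c, 't, 'v) trace_model \<Rightarrow> 'j set \<Rightarrow> ('j \<Rightarrow> ('c, 't) process) \<Rightarrow> ('c, 't) process" where
  "network_composition M J proc =
     (let S = (\<Union>j\<in>J. fst (proc j))
      in (S, {t \<in> carrier (traces M S). \<forall>j\<in>J. trace_restr M S (fst (proc j)) t \<in> snd (proc j)}))"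

definition computes ::
    "('c, 't, 'v) trace_model \<Rightarrow> 'c set \<Rightarrow> 'c set \<Rightarrow> ('c, 't) process \<Rightarrow>
     (('c \<Rightarrow> 'v) \<Rightarrow> 'c \<Rightarrow> 'v) set \<Rightarrow> bool" where
  "computes M I Out = (\<lambda>(S, P) F.
     is_process M (S, P) \<and> S = I \<union> Out \<and> F \<subseteq> continuous_maps (vals M I) (vals M Out) \<and>
     (\<forall>t\<in>carrier (traces M S). t \<in> P \<longleftrightarrow>
        (\<exists>f\<in>F. obs_restr M S Out t = f (obs_restr M S I t) \<and>
           (\<forall>u v. covers_rel (traces M S) t u v \<longrightarrow>
              obs_restr M S Out v \<sqsubseteq>\<^bsub>vals M Out\<^esub> f (obs_restr M S I u)))))"

definition nondet_functional_network ::
    "('c, 't, 'v) trace_model \<Rightarrow> 'j set \<Rightarrow> ('j \<Rightarrow> 'c set) \<Rightarrow> ('j \<Rightarrow> 'c set) \<Rightarrow>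
     ('j \<Rightarrow> ('c, 't) process) \<Rightarrow> ('j \<Rightarrow> (('c \<Rightarrow> 'v) \<Rightarrow> 'c \<Rightarrow> 'v) set) \<Rightarrow> bool" where
  "nondet_functional_network M J I Out proc F \<longleftrightarrow>
     (\<forall>j\<in>J. computes M (I j) (Out j) (proc j) (F j)) \<and>
     (\<forall>\<alpha>\<in>(\<Union>j\<in>J. fst (proc j)). \<exists>!j. j \<in> J \<and> \<alpha> \<in> Out j)"

definition network_map ::
    "'c set \<Rightarrow> 'j set \<Rightarrow> ('j \<Rightarrow> 'c set) \<Rightarrow> ('j \<Rightarrow> 'c set) \<Rightarrow>
     ('j \<Rightarrow> ('c \<Rightarrow> 'v) \<Rightarrow> 'c \<Rightarrow> 'v) \<Rightarrow> ('c \<Rightarrow> 'v) \<Rightarrow> 'c \<Rightarrow> 'v" where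
  "network_map S J I Out f x =
     (\<lambda>\<alpha>\<in>S. let j = (THE j. j \<in> J \<and> \<alpha> \<in> Out j) in f j (restrict x (I j)) \<alpha>)"

end

theory Submission
  imports Defs
begin

text \<open>
  Let \<open>t \<in> P\<close>, and let each \<open>f j\<close> witness that the restriction of \<open>t\<close> is a trace of the
  \<open>j\<close>-th process. By the first condition of \<open>computes\<close>, the observation of \<open>t\<close> is a fixed point of
  the network map \<open>G\<close>, hence above all iterates \<open>(G ^^ k) \<bottom>\<close>. Conversely, a compact \<open>b \<sqsubseteq> t\<close> is
  reached from \<open>\<bottom>\<close> by a finite covering chain. By the second condition, each step of this chain
  is dominated by one more application of \<open>G\<close>, because its image in the \<open>j\<close>-th process is again a
  cover or is stationary. So the observation of \<open>b\<close> lies below some iterate. As \<open>t\<close> is the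
  supremum of such \<open>b\<close>, continuity shows that its observation is the supremum of the iterates.
\<close>

section \<open>Scott-continuous maps and compact elements\<close>

lemma scott_continuous_closed:
  "\<lbrakk>scott_continuous D E f; x \<in> carrier D\<rbrakk> \<Longrightarrow> f x \<in> carrier E"
  by (auto simp: scott_continuous_def)

text \<open>For \<open>x\<close> below \<open>y\<close> the pair \<open>{x, y}\<close> is directed
  with supremum \<open>y\<close>, so continuity makes \<open>f y\<close> an upper bound of
  \<open>f x\<close>.\<close>

lemma scott_continuous_mono:
  assumes D: "partial_order D" and f: "scott_continuous D E f"
    and xy: "x \<in> carrier D" "y \<in> carrier D" "x \<sqsubseteq>\<^bsub>D\<^esub> y"
  shows "f x \<sqsubseteq>\<^bsub>E\<^esub> f y"
proof -
  interpret partial_order D by fact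
  have "directed D {x, y}"
    using xy by (auto simp: directed_def)
  moreover have "is_lub D y {x, y}"
    using xy by (intro least_UpperI) auto
  ultimately have "is_lub E (f y) (f ` {x, y})"
    using f unfolding scott_continuous_def by blast
  moreover have "f ` {x, y} \<subseteq> carrier E"
    using f xy by (auto simp: scott_continuous_closed)
  ultimately show ?thesis
    by (auto intro: least_Upper_above)
qed

lemma (in cpo) bottom_compact: "\<bottom> \<in> compacts L"
  unfolding compacts_def directed_def by (auto intro: bottom_lower)

text \<open>By algebraicity \<open>c\<close> is the supremum of the directed set of compacts below
  it. If \<open>c\<close> were not one of them, each compact above \<open>b\<close> in this set
  would have to be \<open>b\<close> itself, so \<open>b\<close> would bound the whole set and hence
  \<open>c\<close>. This supplies the compactness that \<open>covers_rel\<close> demands of the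
  links of a covering chain.\<close>

lemma (in omega_algebraic_cpo) covers_compact:
  assumes b: "b \<in> compacts D" and cov: "covers D b c"
  shows "c \<in> compacts D"
proof -
  let ?K = "compacts_below D c"
  have c: "b \<in> carrier D" "c \<in> carrier D" "b \<sqsubseteq> c" "b \<noteq> c"
    and btw: "\<And>z. \<lbrakk>z \<in> carrier D; b \<sqsubseteq> z; z \<sqsubseteq> c\<rbrakk> \<Longrightarrow> z = b \<or> z = c"
    using cov by (auto simp: covers_def lless_def eq_is_equal)
  have dir: "directed D ?K" and lub: "is_lub D c ?K"
    using c directed_compacts_below lub_compacts_below by auto
  have bK: "b \<in> ?K"
    using b c by (simp add: compacts_below_def)
  have "c \<in> ?K"
  proof (rule ccontr)
    assume cK: "c \<notin> ?K"
    have "a \<sqsubseteq> b" if a: "a \<in> ?K" for a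
    proof -
      obtain z where z: "z \<in> ?K" "a \<sqsubseteq> z" "b \<sqsubseteq> z"
        using dir a bK unfolding directed_def by blast
      then have "z \<in> carrier D" "z \<sqsubseteq> c"
        by (auto simp: compacts_below_def compacts_def)
      with z btw cK show ?thesis by blast
    qed
    then have "b \<in> Upper D ?K"
      using c by (auto intro: Upper_memI)
    then have "c \<sqsubseteq> b"
      using lub by (blast intro: least_le)
    with c show False by (auto dest: le_antisym)
  qed
  then show ?thesis by (simp add: compacts_below_def)
qed

text \<open>Induction along a covering chain from \<open>\<bottom>\<close> to \<open>b\<close>:
  every link lies below \<open>b\<close>, hence below \<open>d\<close>, so each step is a cover
  relative to \<open>d\<close>.\<close>

lemma (in incremental_domain) compacts_below_induct [consumes 2, case_names bottom cover]:
  assumes d: "d \<in> carrier D" and b: "b \<in> compacts_below D d"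
    and bottom: "Q \<bottom>"
    and step: "\<And>u v. \<lbrakk>covers_rel D d u v; Q u\<rbrakk> \<Longrightarrow> Q v"
  shows "Q b"
proof -
  have "b \<in> compacts D" "b \<sqsubseteq> d" "b \<in> carrier D"
    using b by (auto simp: compacts_below_def compacts_def)
  then have "(covers D)\<^sup>*\<^sup>* \<bottom> b"
    by (intro covering_chain) (auto simp: bottom_compact)
  \<comment> \<open>Compactness is carried along because the chain consists of plain covers. Being
    below \<open>d\<close> is a premise because it passes down the chain, against the direction of
    the induction.\<close>
  then have "b \<in> compacts D \<and> (b \<sqsubseteq> d \<longrightarrow> Q b)"
  proof (induction rule: rtranclp_induct)
    case base
    show ?case by (simp add: bottom bottom_compact)
  next
    case (step u v)
    then have v: "v \<in> compacts D"
      using covers_compact by blast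
    have uv: "u \<in> carrier D" "v \<in> carrier D" "u \<sqsubseteq> v"
      using step.hyps by (auto simp: covers_def lless_def)
    have "Q v" if "v \<sqsubseteq> d"
    proof -
      have "u \<sqsubseteq> d"
        using le_trans uv that d by blast
      then show ?thesis
        using step v that assms(4)[of u v] by (auto simp: covers_rel_def compacts_below_def)
    qed
    with v show ?case by blast
  qed
  with \<open>b \<sqsubseteq> d\<close> show ?thesis by blast
qed

section \<open>Products of partial orders\<close>

lemma product_order_carrier:
  "carrier (product_order S V) = (\<Pi>\<^sub>E \<alpha>\<in>S. carrier (V \<alpha>))"
  by (simp add: product_order_def)

lemma product_order_le:
  "x \<sqsubseteq>\<^bsub>product_order S V\<^esub> y \<longleftrightarrow> (\<forall>\<alpha>\<in>S. x \<alpha> \<sqsubseteq>\<^bsub>V \<alpha>\<^esub> y \<alpha>)"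
  by (simp add: product_order_def)

lemma product_order_partial_order:
  assumes "\<And>\<alpha>. \<alpha> \<in> S \<Longrightarrow> partial_order (V \<alpha>)"
  shows "partial_order (product_order S V)"
proof unfold_locales
  fix x y
  assume "x \<sqsubseteq>\<^bsub>product_order S V\<^esub> y" "y \<sqsubseteq>\<^bsub>product_order S V\<^esub> x"
    "x \<in> carrier (product_order S V)" "y \<in> carrier (product_order S V)"
  \<comment> \<open>Elements of the carrier are extensional, so agreement on \<open>S\<close> is
    equality.\<close>
  then have "x = y"
    unfolding product_order_carrier product_order_le
    by (intro PiE_ext) (auto intro: partial_order.le_antisym[OF assms])
  then show "x .=\<^bsub>product_order S V\<^esub> y"
    by (simp add: product_order_def)
next
  fix x assume "x \<in> carrier (product_order S V)"
  then show "x \<sqsubseteq>\<^bsub>product_order S V\<^esub> x"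
    unfolding product_order_carrier product_order_le
    using assms by (auto intro!: weak_partial_order.le_refl partial_order.axioms(1))
next
  fix x y z
  assume xy: "x \<sqsubseteq>\<^bsub>product_order S V\<^esub> y" "y \<sqsubseteq>\<^bsub>product_order S V\<^esub> z"
    "x \<in> carrier (product_order S V)" "y \<in> carrier (product_order S V)"
    "z \<in> carrier (product_order S V)"
  show "x \<sqsubseteq>\<^bsub>product_order S V\<^esub> z"
    unfolding product_order_le
  proof
    fix \<alpha> assume \<alpha>: "\<alpha> \<in> S"
    interpret partial_order "V \<alpha>" using assms \<alpha> .
    show "x \<alpha> \<sqsubseteq>\<^bsub>V \<alpha>\<^esub> z \<alpha>"
      using xy \<alpha> unfolding product_order_le product_order_carrier
      by (blast intro: le_trans)
  qed
qed (auto simp: product_order_def)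

text \<open>The bottom of an order is chosen by \<open>SOME\<close>; the componentwise bottom shows
  that a least element exists to be chosen.\<close>

lemma product_order_bottom:
  assumes "\<And>\<alpha>. \<alpha> \<in> S \<Longrightarrow> weak_partial_order_bottom (V \<alpha>)"
  shows "least (product_order S V) \<bottom>\<^bsub>product_order S V\<^esub> (carrier (product_order S V))"
proof -
  have "least (product_order S V) (\<lambda>\<alpha>\<in>S. \<bottom>\<^bsub>V \<alpha>\<^esub>) (carrier (product_order S V))"
    unfolding least_def product_order_carrier product_order_le
    using assms
    by (auto simp: weak_partial_order_bottom.bottom_closed
        intro!: weak_partial_order_bottom.bottom_lower)
  then show ?thesis
    unfolding bottom_def[of "product_order S V"]
    by (rule someI[where P = "\<lambda>x. least _ x (carrier _)"])
qed

section \<open>Values, restrictions and observations in a model\<close>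

context model
begin

lemma vals_partial_order: "partial_order (vals M S)"
  unfolding vals_def
  using channel_vals_cpo cpo.axioms(1) by (blast intro: product_order_partial_order)

lemma vals_bottom: "least (vals M S) \<bottom>\<^bsub>vals M S\<^esub> (carrier (vals M S))"
  unfolding vals_def
  using channel_vals_cpo cpo.axioms(2) by (blast intro: product_order_bottom)

lemma vals_carrier: "carrier (vals M S) = (\<Pi>\<^sub>E \<alpha>\<in>S. carrier (channel_vals M \<alpha>))"
  by (simp add: vals_def product_order_carrier)

lemma vals_le: "x \<sqsubseteq>\<^bsub>vals M S\<^esub> y \<longleftrightarrow> (\<forall>\<alpha>\<in>S. x \<alpha> \<sqsubseteq>\<^bsub>channel_vals M \<alpha>\<^esub> y \<alpha>)"
  by (simp add: vals_def product_order_le)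

lemma vals_restrict:
  "\<lbrakk>x \<in> carrier (vals M S); T \<subseteq> S\<rbrakk> \<Longrightarrow> restrict x T \<in> carrier (vals M T)"
  by (auto simp: vals_carrier)

lemma restr_closed:
  "\<lbrakk>T \<subseteq> S; t \<in> carrier (traces M S)\<rbrakk> \<Longrightarrow> trace_restr M S T t \<in> carrier (traces M T)"
  using trace_restr_strict_continuous[of T S]
  by (auto simp: strict_continuous_def intro: scott_continuous_closed)

lemma obs_closed: "t \<in> carrier (traces M S) \<Longrightarrow> obs M S t \<in> carrier (vals M S)"
  using obs_strict_continuous[of S]
  by (auto simp: strict_continuous_def intro: scott_continuous_closed)

text \<open>Functoriality of restriction and naturality of observation. It turns conditions on the
  trace of a single process into conditions on one global observation.\<close>

lemma obs_restr_restr: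
  assumes "U \<subseteq> T" "T \<subseteq> S" "t \<in> carrier (traces M S)"
  shows "obs_restr M T U (trace_restr M S T t) = restrict (obs M S t) U"
  using assms by (simp add: obs_restr_def trace_restr_trans obs_natural)

end

section \<open>Functional networks and the functions behind a composite trace\<close>

locale functional_network = incremental_model M for M :: "('c, 't, 'v) trace_model" +
  fixes J :: "'j set"
    and I Out :: "'j \<Rightarrow> 'c set"
    and proc :: "'j \<Rightarrow> ('c, 't) process"
    and F :: "'j \<Rightarrow> (('c \<Rightarrow> 'v) \<Rightarrow> 'c \<Rightarrow> 'v) set"
    and S :: "'c set" and P :: "'t set"
  assumes network: "nondet_functional_network M J I Out proc F"
    and composition: "(S, P) = network_composition M J proc"
begin

lemma sort_eq: "S = (\<Union>j\<in>J. fst (proc j))"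
  using composition by (simp add: network_composition_def Let_def)

lemma composite_trace:
  assumes "t \<in> P"
  shows "t \<in> carrier (traces M S)"
    and "j \<in> J \<Longrightarrow> trace_restr M S (fst (proc j)) t \<in> snd (proc j)"
  using assms composition by (auto simp: network_composition_def Let_def)

lemma process_computes: "j \<in> J \<Longrightarrow> computes M (I j) (Out j) (proc j) (F j)"
  using network by (simp add: nondet_functional_network_def)

lemma process_sort: "j \<in> J \<Longrightarrow> fst (proc j) = I j \<union> Out j"
  using process_computes[of j] by (auto simp: computes_def split: prod.splits)

lemma process_sort_subset: "j \<in> J \<Longrightarrow> fst (proc j) \<subseteq> S"
  by (auto simp: sort_eq)

lemma input_subset: "j \<in> J \<Longrightarrow> I j \<subseteq> S"
  using process_sort process_sort_subset by blast

lemma functions_continuous: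
  "\<lbrakk>j \<in> J; g \<in> F j\<rbrakk> \<Longrightarrow> scott_continuous (vals M (I j)) (vals M (Out j)) g"
  using process_computes[of j] by (auto simp: computes_def continuous_maps_def split: prod.splits)

text \<open>Each channel is an output of exactly one process, so the definite description in
  \<open>network_map\<close> denotes that process.\<close>

lemma producer:
  assumes "\<alpha> \<in> S"
  obtains j where "j \<in> J" "\<alpha> \<in> Out j" "(THE j. j \<in> J \<and> \<alpha> \<in> Out j) = j"
proof -
  have "\<exists>!j. j \<in> J \<and> \<alpha> \<in> Out j"
    using network assms unfolding nondet_functional_network_def sort_eq by blast
  then show ?thesis
    using that by (metis (mono_tags, lifting) theI')
qed

lemma process_trace_function:
  assumes j: "j \<in> J" and t: "t \<in> P"
  obtains g where "g \<in> F j"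
    and "restrict (obs M S t) (Out j) = g (restrict (obs M S t) (I j))"
    and "\<And>u v. covers_rel (traces M (fst (proc j))) (trace_restr M S (fst (proc j)) t) u v \<Longrightarrow>
      obs_restr M (fst (proc j)) (Out j) v \<sqsubseteq>\<^bsub>vals M (Out j)\<^esub>
        g (obs_restr M (fst (proc j)) (I j) u)"
proof -
  let ?T = "fst (proc j)"
  note t = composite_trace[OF t]
  have T: "?T \<subseteq> S" "I j \<subseteq> ?T" "Out j \<subseteq> ?T"
    using j process_sort process_sort_subset by auto
  obtain g where "g \<in> F j"
    and "obs_restr M ?T (Out j) (trace_restr M S ?T t) = g (obs_restr M ?T (I j) (trace_restr M S ?T t))"
    and "\<And>u v. covers_rel (traces M ?T) (trace_restr M S ?T t) u v \<Longrightarrow>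
      obs_restr M ?T (Out j) v \<sqsubseteq>\<^bsub>vals M (Out j)\<^esub> g (obs_restr M ?T (I j) u)"
    using process_computes[OF j] t(2)[OF j] restr_closed[OF T(1) t(1)]
    unfolding computes_def by (auto simp: case_prod_beta)
  then show ?thesis
    using that T t(1) by (simp add: obs_restr_restr)
qed

section \<open>A fixed composite trace \<open>t\<close> and a family \<open>f\<close> witnessing its
  membership in every process\<close>

context
  fixes t f
  assumes t: "t \<in> P"
    and f: "\<And>j. j \<in> J \<Longrightarrow> f j \<in> F j"
    and fixed: "\<And>j. j \<in> J \<Longrightarrow>
      restrict (obs M S t) (Out j) = f j (restrict (obs M S t) (I j))"
    and causal: "\<And>j u v. \<lbrakk>j \<in> J;
      covers_rel (traces M (fst (proc j))) (trace_restr M S (fst (proc j)) t) u v\<rbrakk> \<Longrightarrow>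
      obs_restr M (fst (proc j)) (Out j) v \<sqsubseteq>\<^bsub>vals M (Out j)\<^esub>
        f j (obs_restr M (fst (proc j)) (I j) u)"
begin

abbreviation (input) "G \<equiv> network_map S J I Out f"
abbreviation (input) "iterate k \<equiv> (G ^^ k) \<bottom>\<^bsub>vals M S\<^esub>"

interpretation V: partial_order "vals M S"
  by (rule vals_partial_order)

text \<open>The index \<open>j\<close> depends on \<open>\<alpha>\<close> alone, so values of
  \<open>G\<close> at different arguments can be compared at \<open>\<alpha>\<close> through the
  same \<open>f j\<close>.\<close>

lemma network_map_component:
  assumes "\<alpha> \<in> S"
  obtains j where "j \<in> J" "\<alpha> \<in> Out j" "\<And>x. G x \<alpha> = f j (restrict x (I j)) \<alpha>"
proof -
  obtain j where "j \<in> J" "\<alpha> \<in> Out j" "(THE j. j \<in> J \<and> \<alpha> \<in> Out j) = j"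
    using assms by (rule producer)
  with that assms show ?thesis
    by (simp add: network_map_def)
qed

lemma function_closed:
  "\<lbrakk>j \<in> J; x \<in> carrier (vals M S)\<rbrakk> \<Longrightarrow> f j (restrict x (I j)) \<in> carrier (vals M (Out j))"
  using f functions_continuous input_subset vals_restrict scott_continuous_closed by metis

lemma function_mono:
  assumes "j \<in> J" "x \<in> carrier (vals M S)" "y \<in> carrier (vals M S)" "x \<sqsubseteq>\<^bsub>vals M S\<^esub> y"
  shows "f j (restrict x (I j)) \<sqsubseteq>\<^bsub>vals M (Out j)\<^esub> f j (restrict y (I j))"
proof (rule scott_continuous_mono[where f = "f j"])
  show "scott_continuous (vals M (I j)) (vals M (Out j)) (f j)"
    using assms f functions_continuous by blast
qed (use assms input_subset[of j] in \<open>auto simp: vals_le vals_restrict vals_partial_order\<close>)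

lemma network_map_closed:
  assumes "x \<in> carrier (vals M S)"
  shows "G x \<in> carrier (vals M S)"
proof -
  have "G x \<alpha> \<in> carrier (channel_vals M \<alpha>)" if "\<alpha> \<in> S" for \<alpha>
    using that function_closed[OF _ assms]
    by (elim network_map_component) (auto simp: vals_carrier)
  then show ?thesis
    by (auto simp: vals_carrier network_map_def)
qed

lemma network_map_mono:
  assumes "x \<in> carrier (vals M S)" "y \<in> carrier (vals M S)" "x \<sqsubseteq>\<^bsub>vals M S\<^esub> y"
  shows "G x \<sqsubseteq>\<^bsub>vals M S\<^esub> G y"
  unfolding vals_le
proof
  fix \<alpha> assume "\<alpha> \<in> S"
  then show "G x \<alpha> \<sqsubseteq>\<^bsub>channel_vals M \<alpha>\<^esub> G y \<alpha>"
    using function_mono[OF _ assms]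
    by (elim network_map_component) (auto simp: vals_le)
qed

lemma iterate_closed: "iterate k \<in> carrier (vals M S)"
  by (induction k) (use vals_bottom in \<open>auto intro: network_map_closed\<close>)

text \<open>Used to pass from the bound \<open>iterate k\<close> to \<open>iterate (Suc k)\<close>
  when a covering step is stationary in the process producing a channel.\<close>

lemma iterate_chain: "iterate k \<sqsubseteq>\<^bsub>vals M S\<^esub> iterate (Suc k)"
proof (induction k)
  case 0
  show ?case
    using vals_bottom iterate_closed[of 1] by (auto simp: least_def)
next
  case (Suc k)
  then have "G (iterate k) \<sqsubseteq>\<^bsub>vals M S\<^esub> G (iterate (Suc k))"
    by (intro network_map_mono iterate_closed)
  then show ?case
    by simp
qed

text \<open>At each channel this is the equation \<open>fixed\<close> for the process that produces
  it; both sides are extensional on \<open>S\<close>.\<close>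

lemma obs_fixed_point: "G (obs M S t) = obs M S t"
proof (rule PiE_ext)
  have obs_t: "obs M S t \<in> carrier (vals M S)"
    using t composite_trace(1) obs_closed by blast
  then show "G (obs M S t) \<in> (\<Pi>\<^sub>E \<alpha>\<in>S. carrier (channel_vals M \<alpha>))"
    and "obs M S t \<in> (\<Pi>\<^sub>E \<alpha>\<in>S. carrier (channel_vals M \<alpha>))"
    using network_map_closed by (simp_all add: vals_carrier)
  show "G (obs M S t) \<alpha> = obs M S t \<alpha>" if "\<alpha> \<in> S" for \<alpha>
    using that
  proof (rule network_map_component)
    fix j assume "j \<in> J" "\<alpha> \<in> Out j" "\<And>x. G x \<alpha> = f j (restrict x (I j)) \<alpha>"
    then show ?thesis
      using fixed[of j] by (metis restrict_apply')
  qed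
qed

lemma iterate_le_obs: "iterate k \<sqsubseteq>\<^bsub>vals M S\<^esub> obs M S t"
proof (induction k)
  case 0
  show ?case
    using vals_bottom t composite_trace(1) obs_closed by (auto simp: least_def)
next
  case (Suc k)
  then have "G (iterate k) \<sqsubseteq>\<^bsub>vals M S\<^esub> G (obs M S t)"
    using network_map_mono iterate_closed t composite_trace(1) obs_closed by blast
  then show ?case
    by (simp add: obs_fixed_point)
qed

lemma obs_compact_le_iterate:
  assumes "b \<in> compacts_below (traces M S) t"
  shows "\<exists>k. obs M S b \<sqsubseteq>\<^bsub>vals M S\<^esub> iterate k"
proof -
  interpret D: incremental_domain "traces M S"
    by (rule traces_incremental)
  have tc: "t \<in> carrier (traces M S)"
    using t by (rule composite_trace)
  show ?thesis
    using tc assms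
  proof (induction rule: D.compacts_below_induct)
    case bottom
    \<comment> \<open>Strictness of the observation gives exactly the starting point of the
      iteration.\<close>
    have "obs M S \<bottom>\<^bsub>traces M S\<^esub> = iterate 0"
      using obs_strict_continuous[of S] by (simp add: strict_continuous_def)
    then show ?case
      using iterate_closed V.le_refl by metis
  next
    case (cover u v)
    then obtain k where k: "obs M S u \<sqsubseteq>\<^bsub>vals M S\<^esub> iterate k" by blast
    have uv: "u \<in> carrier (traces M S)" "v \<in> carrier (traces M S)"
      using cover by (auto simp: covers_rel_def compacts_below_def compacts_def)
    \<comment> \<open>Processes may see the cover differently, but the same bound
      \<open>Suc k\<close> serves every channel, even with infinitely many processes.\<close>
    have step: "obs M S v \<alpha> \<sqsubseteq>\<^bsub>channel_vals M \<alpha>\<^esub> iterate (Suc k) \<alpha>" if \<alpha>: "\<alpha> \<in> S" for \<alpha>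
    proof -
      obtain j where j: "j \<in> J" "\<alpha> \<in> Out j"
        and G: "\<And>x. G x \<alpha> = f j (restrict x (I j)) \<alpha>"
        using network_map_component[OF \<alpha>] by metis
      let ?T = "fst (proc j)" and ?r = "trace_restr M S (fst (proc j))"
      have T: "?T \<subseteq> S" "I j \<subseteq> ?T" "Out j \<subseteq> ?T"
        using j process_sort process_sort_subset by auto
      interpret r: incremental_morphism "traces M S" "traces M ?T" ?r
        using T(1) by (rule trace_restr_incremental)
      consider "covers_rel (traces M ?T) (?r t) (?r u) (?r v)" | "?r u = ?r v"
        using r.preserves_covers[OF tc cover(1)] by blast
      then show ?thesis
      proof cases
        case 1
        interpret C: partial_order "vals M (Out j)" by (rule vals_partial_order)
        \<comment> \<open>Causality bounds the output at \<open>v\<close> by the input at the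
          earlier \<open>u\<close>. The induction hypothesis at \<open>u\<close> therefore costs
          just one more application of \<open>G\<close>.\<close>
        have "restrict (obs M S v) (Out j) \<sqsubseteq>\<^bsub>vals M (Out j)\<^esub> f j (restrict (obs M S u) (I j))"
          using causal[OF j(1) 1] T uv by (simp add: obs_restr_restr)
        moreover have "f j (restrict (obs M S u) (I j)) \<sqsubseteq>\<^bsub>vals M (Out j)\<^esub>
            f j (restrict (iterate k) (I j))"
          using function_mono[OF j(1) obs_closed[OF uv(1)] iterate_closed k] .
        ultimately have "restrict (obs M S v) (Out j) \<sqsubseteq>\<^bsub>vals M (Out j)\<^esub>
            f j (restrict (iterate k) (I j))"
          using C.le_trans[OF _ _ vals_restrict[OF obs_closed[OF uv(2)]]
              function_closed[OF j(1) obs_closed[OF uv(1)]] function_closed[OF j(1) iterate_closed]]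
            T by blast
        then show ?thesis
          using j G by (simp add: vals_le)
      next
        case 2
        \<comment> \<open>Process \<open>j\<close> does not distinguish \<open>u\<close> from
          \<open>v\<close>, so the channel \<open>\<alpha>\<close> it produces has not
          changed.\<close>
        have "restrict (obs M S u) (Out j) = restrict (obs M S v) (Out j)"
          using 2 T uv obs_restr_restr by metis
        then have "obs M S v \<alpha> = obs M S u \<alpha>"
          using j by (metis restrict_apply')
        moreover have "obs M S u \<sqsubseteq>\<^bsub>vals M S\<^esub> iterate (Suc k)"
          using V.le_trans[OF k iterate_chain obs_closed[OF uv(1)] iterate_closed iterate_closed] .
        ultimately show ?thesis
          using \<alpha> by (simp add: vals_le)
      qed
    qed
    have "obs M S v \<sqsubseteq>\<^bsub>vals M S\<^esub> iterate (Suc k)"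
      unfolding vals_le using step by blast
    then show ?case by blast
  qed
qed

lemma obs_eq_lfp: "obs M S t = kleene_lfp (vals M S) G"
proof -
  interpret D: incremental_domain "traces M S"
    by (rule traces_incremental)
  let ?K = "compacts_below (traces M S) t"
  have tc: "t \<in> carrier (traces M S)"
    using t by (rule composite_trace)
  \<comment> \<open>Algebraicity writes \<open>t\<close> as the directed supremum of the compacts
    below it, and continuity transports this supremum.\<close>
  have lub_K: "is_lub (vals M S) (obs M S t) (obs M S ` ?K)"
    using obs_strict_continuous[of S] D.directed_compacts_below[OF tc] D.lub_compacts_below[OF tc]
    by (simp add: strict_continuous_def scott_continuous_def)
  \<comment> \<open>An upper bound of the iterates bounds the observations of all compacts below
    \<open>t\<close>, hence also their supremum.\<close>
  have lub: "is_lub (vals M S) (obs M S t) (range iterate)"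
  proof (rule least_UpperI)
    fix y assume y: "y \<in> Upper (vals M S) (range iterate)"
    then have yc: "y \<in> carrier (vals M S)"
      by (auto simp: Upper_def)
    have it: "iterate k \<sqsubseteq>\<^bsub>vals M S\<^esub> y" for k
      using y iterate_closed by (auto simp: Upper_def)
    have "obs M S b \<sqsubseteq>\<^bsub>vals M S\<^esub> y" if b: "b \<in> ?K" for b
    proof -
      have bc: "obs M S b \<in> carrier (vals M S)"
        using b by (intro obs_closed) (simp add: compacts_below_def compacts_def)
      obtain k where "obs M S b \<sqsubseteq>\<^bsub>vals M S\<^esub> iterate k"
        using obs_compact_le_iterate[OF b] by blast
      then show ?thesis
        using it bc iterate_closed yc by (rule V.le_trans)
    qed
    then have "y \<in> Upper (vals M S) (obs M S ` ?K)"
      using yc by (auto intro: Upper_memI)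
    with lub_K show "obs M S t \<sqsubseteq>\<^bsub>vals M S\<^esub> y"
      by (rule least_le)
  qed (use iterate_le_obs iterate_closed tc in \<open>auto intro: obs_closed\<close>)
  \<comment> \<open>\<open>kleene_lfp\<close> takes a least upper bound chosen by
    \<open>SOME\<close>; uniqueness identifies it with the one just exhibited.\<close>
  then show ?thesis
    unfolding kleene_lfp_def sup_def
    by (metis (mono_tags, lifting) V.least_unique someI)
qed

end

section \<open>Choosing one function per process\<close>

lemma obs_composite_trace:
  assumes t: "t \<in> P"
  obtains f where "f \<in> (\<Pi>\<^sub>E j\<in>J. F j)"
    and "obs M S t = kleene_lfp (vals M S) (network_map S J I Out f)"
proof -
  \<comment> \<open>Both conditions are gathered in one predicate so that a single choice yields an
    \<open>h j\<close> satisfying them together.\<close>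
  define R where "R j g \<longleftrightarrow> g \<in> F j \<and>
    restrict (obs M S t) (Out j) = g (restrict (obs M S t) (I j)) \<and>
    (\<forall>u v. covers_rel (traces M (fst (proc j))) (trace_restr M S (fst (proc j)) t) u v \<longrightarrow>
      obs_restr M (fst (proc j)) (Out j) v \<sqsubseteq>\<^bsub>vals M (Out j)\<^esub>
        g (obs_restr M (fst (proc j)) (I j) u))" for j g
  have "\<exists>g. R j g" if "j \<in> J" for j
    using process_trace_function[OF that t] unfolding R_def by metis
  then obtain h where h: "\<And>j. j \<in> J \<Longrightarrow> R j (h j)"
    by metis
  \<comment> \<open>Members of the product are extensional families, hence the restriction to
    \<open>J\<close>.\<close>
  define f where "f = restrict h J"
  have f: "R j (f j)" if "j \<in> J" for j
    using h that by (simp add: f_def)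
  show ?thesis
  proof (rule that)
    show "f \<in> (\<Pi>\<^sub>E j\<in>J. F j)"
      using h by (auto simp: f_def R_def)
    show "obs M S t = kleene_lfp (vals M S) (network_map S J I Out f)"
      by (rule obs_eq_lfp[OF t]) (use f in \<open>auto simp: R_def\<close>)
  qed
qed

end

theorem theorem1:
  fixes M :: "('c, 't, 'v) trace_model"
    and J :: "'j set"
    and I Out :: "'j \<Rightarrow> 'c set"
    and proc :: "'j \<Rightarrow> ('c, 't) process"
    and F :: "'j \<Rightarrow> (('c \<Rightarrow> 'v) \<Rightarrow> 'c \<Rightarrow> 'v) set"
    and S :: "'c set" and P :: "'t set"
  assumes "incremental_model M"
    and "nondet_functional_network M J I Out proc F"
    and "(S, P) = network_composition M J proc"
  shows "obs M S ` P \<subseteq> {kleene_lfp (vals M S) (network_map S J I Out f) |f. f \<in> (\<Pi>\<^sub>E j\<in>J. F j)}"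
proof -
  interpret functional_network M J I Out proc F S P
    using assms by (simp add: functional_network_def functional_network_axioms_def)
  show ?thesis
  proof
    fix x assume "x \<in> obs M S ` P"
    then obtain t where t: "t \<in> P" and x: "x = obs M S t" by blast
    from t obtain f where "f \<in> (\<Pi>\<^sub>E j\<in>J. F j)"
      and "obs M S t = kleene_lfp (vals M S) (network_map S J I Out f)"
      by (rule obs_composite_trace)
    with x show "x \<in> {kleene_lfp (vals M S) (network_map S J I Out f) |f. f \<in> (\<Pi>\<^sub>E j\<in>J. F j)}"
      by blast
  qed
qed

end
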